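(* Let $G=(V,E)$ be a simple undirected graph, $S\subseteq\binom{V}{2}$, let $a^{\mathsf T}x\geq b$ be facet-defining for $\mathrm{MultC}(G,S)$, and let $v$ be a node of $\mathrm{supp}(a)$. Obtain $\overline G=(\overline V,\overline E)$ from $G$ by replacing $v$ by two adjacent new nodes $v_1,v_2$ and distributing the edges incident to $v$ arbitrarily among $v_1$ and $v_2$ (an edge $vw$ becomes $v_1w$ or $v_2w$). Obtain $\overline S$ from $S$ by replacing each pair $\{v,t\}\in S$ independently by a (not necessarily strict) subset of $\{\{v_1,t\},\{v_2,t\}\}$ (pairs not containing $v$ are kept). Define $\varphi:\overline E\setminus\{v_1v_2\}\to E$ by $\varphi(e)=e$ if $v_1,v_2\notin e$ and $\varphi(e)=vw$ if $e=v_iw$ ($i=1,2$). Let $\omega$ be the weight of a minimum $\overline S$-multicut in $\overline G-v_1v_2$ with respect to the edge weights $a_{\varphi(e')}$, $e'\in\overline E\setminus\{v_1v_2\}$. Define $\bar a\in\mathbb{R}^{\overline E}$ by $\bar a_{v_1v_2}=b-\omega$ and $\bar a_e=a_{\varphi(e)}$ otherwise. Then $\bar a^{\mathsf T}x\geq b$ defines a facet of $\mathrm{MultC}(\overline G,\overline S)$. In particular, if $a^{\mathsf T}x\geq b$ defines a shared facet of $\mathrm{MultC}(G,S)$, then $\bar a^{\mathsf T}x\geq b$ defines a shared facet of $\mathrm{MultC}(\overline G,\overline S)$.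
   Context: Given a graph $G=(V,E)$ and $S\subseteq\binom{V}{2}$, an ($S$-)multicut is a set $\delta\subseteq E$ such that for every $\{s,t\}\in S$ the nodes $s$ and $t$ lie in different components of $G-\delta$. For $F\subseteq E$, $x^F\in\mathbb{R}^E$ is its incidence vector. The multicut polytope is $\mathrm{MultC}^{\square}(G,S)=\mathrm{conv}\{x^\delta:\delta\text{ an } S\text{-multicut}\}$ and the multicut dominant is $\mathrm{MultC}(G,S)=\mathrm{MultC}^{\square}(G,S)+\mathbb{R}^E_{\geq 0}$. A facet-defining inequality of $\mathrm{MultC}(G,S)$ defines a shared facet if it is also facet-defining for $\mathrm{MultC}^{\square}(G,S)$. $\mathrm{supp}(a)$ is the subgraph of $G$ induced by the edge set $\{e:a_e\neq0\}$.
   Formalization: Each pair {v,t} in S must be replaced by a nonempty subset of {{v1,t},{v2,t}}; the shared-facet claim additionally assumes that for every edge vw of G with {v,w} in S, the edge v_iw replacing it is again a pair of the new S. Both claims fail without these conditions. *)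

theory Defs
  imports "HOL-Analysis.Analysis"
begin

(* Nodes are drawn from an arbitrary finite type; a graph is a node set V together with a set E of
   two-element subsets of V. Graphs on different node and edge sets thus live side by side, and
   the space R^E is the coordinate subspace edge_space E of the Euclidean space indexed by all
   sets of nodes. *)

definition node_pairs :: "'v set \<Rightarrow> 'v set set" where
  "node_pairs V = {e. e \<subseteq> V \<and> card e = 2}"

definition simple_graph :: "'v set \<Rightarrow> 'v set set \<Rightarrow> bool" where
  "simple_graph V E \<longleftrightarrow> E \<subseteq> node_pairs V"

definition adj :: "'v set set \<Rightarrow> ('v \<times> 'v) set" where
  "adj E = {(u, w). {u, w} \<in> E}"

definition component :: "'v set \<Rightarrow> 'v set set \<Rightarrow> 'v \<Rightarrow> 'v set" where
  "component V E u = {w \<in> V. (u, w) \<in> (adj E)\<^sup>*}"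

definition multicut :: "'v set \<Rightarrow> 'v set set \<Rightarrow> 'v set set \<Rightarrow> 'v set set \<Rightarrow> bool" where
  "multicut V E S \<delta> \<longleftrightarrow> \<delta> \<subseteq> E \<and>
     (\<forall>s t. {s, t} \<in> S \<longrightarrow> component V (E - \<delta>) s \<noteq> component V (E - \<delta>) t)"

definition edge_space :: "'v::finite set set \<Rightarrow> (real ^ 'v set) set" where
  "edge_space E = {x. \<forall>e. e \<notin> E \<longrightarrow> x $ e = 0}"

definition incidence :: "'v::finite set set \<Rightarrow> real ^ 'v set" where
  "incidence F = (\<chi> e. if e \<in> F then 1 else 0)"

definition multicut_polytope ::
    "'v::finite set \<Rightarrow> 'v set set \<Rightarrow> 'v set set \<Rightarrow> (real ^ 'v set) set" where
  "multicut_polytope V E S = convex hull (incidence ` {\<delta>. multicut V E S \<delta>})"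

definition multicut_dominant ::
    "'v::finite set \<Rightarrow> 'v set set \<Rightarrow> 'v set set \<Rightarrow> (real ^ 'v set) set" where
  "multicut_dominant V E S =
     {x + y | x y. x \<in> multicut_polytope V E S \<and> y \<in> edge_space E \<and> (\<forall>e. y $ e \<ge> 0)}"

(* The inequality "a x >= b" is valid for P and the face it induces is a facet of P. *)
definition facet_defining :: "'a::euclidean_space set \<Rightarrow> 'a \<Rightarrow> real \<Rightarrow> bool" where
  "facet_defining P a b \<longleftrightarrow> (\<forall>x\<in>P. a \<bullet> x \<ge> b) \<and> (P \<inter> {x. a \<bullet> x = b}) facet_of P"

definition shared_facet_defining ::
    "'v::finite set \<Rightarrow> 'v set set \<Rightarrow> 'v set set \<Rightarrow> real ^ 'v set \<Rightarrow> real \<Rightarrow> bool" where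
  "shared_facet_defining V E S a b \<longleftrightarrow>
     facet_defining (multicut_dominant V E S) a b \<and> facet_defining (multicut_polytope V E S) a b"

definition supp_nodes :: "'v::finite set set \<Rightarrow> real ^ 'v set \<Rightarrow> 'v set" where
  "supp_nodes E a = \<Union>{e \<in> E. a $ e \<noteq> 0}"

definition min_multicut_weight ::
    "'v::finite set \<Rightarrow> 'v set set \<Rightarrow> 'v set set \<Rightarrow> ('v set \<Rightarrow> real) \<Rightarrow> real" where
  "min_multicut_weight V E S c = Min ((\<lambda>\<delta>. \<Sum>e\<in>\<delta>. c e) ` {\<delta>. multicut V E S \<delta>})"

definition split_nodes :: "'v \<Rightarrow> 'v \<Rightarrow> 'v \<Rightarrow> 'v set \<Rightarrow> 'v set" where
  "split_nodes v v1 v2 V = (V - {v}) \<union> {v1, v2}"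

(* The edge vw is moved to the end node h w, which is meant to be v1 or v2. *)
definition split_edges ::
    "'v \<Rightarrow> 'v \<Rightarrow> 'v \<Rightarrow> ('v \<Rightarrow> 'v) \<Rightarrow> 'v set set \<Rightarrow> 'v set set" where
  "split_edges v v1 v2 h E =
     {{v1, v2}} \<union> {e \<in> E. v \<notin> e} \<union> {{h w, w} | w. {v, w} \<in> E}"

(* R t is the set of pairs replacing {v, t}, meant to be a nonempty subset of
   {{v1, t}, {v2, t}}. If pairs could vanish, splitting G = ({v, t}, {vt}) with S = {vt} and
   replacing vt by no pair would turn the facet x_vt >= 1 into an inequality violated by x = 0. *)
definition split_pairs ::
    "'v \<Rightarrow> ('v \<Rightarrow> 'v set set) \<Rightarrow> 'v set set \<Rightarrow> 'v set set" where
  "split_pairs v R S = {p \<in> S. v \<notin> p} \<union> (\<Union>t\<in>{t. {v, t} \<in> S}. R t)"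

definition unsplit_edge :: "'v \<Rightarrow> 'v \<Rightarrow> 'v \<Rightarrow> 'v set \<Rightarrow> 'v set" where
  "unsplit_edge v v1 v2 e =
     (if v1 \<in> e \<or> v2 \<in> e then insert v (e - {v1, v2}) else e)"

end

theory Submission
  imports Defs
begin

text \<open>Points of the original facet lift along the edge bijection \<open>\<phi>\<close> to points of the
  new face with zero coordinate at \<open>v1v2\<close>, because a multicut stays a multicut when
  \<open>v\<close> is split. Adding \<open>v1v2\<close> to a minimum multicut of the split graph without \<open>v1v2\<close> gives one
  more point of the new face, with coordinate 1 there. Hence the dimension of the face grows by at
  least one, while the dimension of the polyhedron grows by at most one. For validity, a multicut
  avoiding \<open>v1v2\<close> contracts to a multicut of the original graph, and one containing it weighs at
  least \<open>\<omega> + (b - \<omega>) = b\<close>.\<close>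

section \<open>Lifting facets along linear maps\<close>

text \<open>A linear image does not raise the affine dimension, and one further direction adds at
  most one. The direction \<open>u\<close> is encoded as the single extra point
  \<open>L x0 + u\<close>.\<close>

lemma aff_dim_le_Suc:
  fixes L :: "'a::euclidean_space \<Rightarrow> 'b::euclidean_space"
  assumes "linear L" "D \<noteq> {}" "\<And>x. x \<in> D' \<Longrightarrow> \<exists>y\<in>D. \<exists>c. x = L y + c *\<^sub>R u"
  shows "aff_dim D' \<le> aff_dim D + 1"
proof -
  from assms(2) obtain x0 where x0: "x0 \<in> D" by auto
  let ?H = "affine hull (insert (L x0 + u) (L ` D))"
  have "D' \<subseteq> ?H"
  proof
    fix x assume "x \<in> D'"
    then obtain y c where y: "y \<in> D" "x = L y + c *\<^sub>R u" using assms(3) by blast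
    have "L y + c *\<^sub>R ((L x0 + u) - L x0) \<in> ?H"
      by (rule mem_affine_3_minus) (use x0 y in \<open>auto intro: hull_inc\<close>)
    then show "x \<in> ?H" using y by simp
  qed
  then have "aff_dim D' \<le> aff_dim (insert (L x0 + u) (L ` D))"
    by (metis aff_dim_affine_hull aff_dim_subset)
  also have "\<dots> \<le> aff_dim (L ` D) + 1"
    by (simp add: aff_dim_insert)
  also have "aff_dim (L ` D) \<le> aff_dim D"
    by (rule aff_dim_linear_image_le[OF assms(1)])
  finally show ?thesis by simp
qed

text \<open>As \<open>K\<close> undoes \<open>L\<close> on \<open>P\<close>, the facet keeps its
  dimension under \<open>L\<close>. Its image lies in the hyperplane where \<open>g\<close> vanishes
  and \<open>p\<close> lies off it, which gains the one dimension by which \<open>P'\<close> may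
  exceed \<open>P\<close>. Leaving \<open>P\<close> abstract serves the dominant and the polytope
  alike.\<close>

lemma facet_defining_lift:
  fixes L :: "'a::euclidean_space \<Rightarrow> 'b::euclidean_space"
  assumes facet: "facet_defining P a b"
    and conv: "convex P'"
    and valid: "\<And>x. x \<in> P' \<Longrightarrow> a' \<bullet> x \<ge> b"
    and K: "linear K" "\<And>x. x \<in> P \<Longrightarrow> K (L x) = x"
    and L: "\<And>x. x \<in> P \<Longrightarrow> L x \<in> P'" "\<And>x. x \<in> P \<Longrightarrow> a' \<bullet> L x = a \<bullet> x"
      "\<And>x. x \<in> P \<Longrightarrow> g \<bullet> L x = 0"
    and p: "p \<in> P'" "a' \<bullet> p = b" "g \<bullet> p \<noteq> 0"
    and dim: "aff_dim P' \<le> aff_dim P + 1"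
  shows "facet_defining P' a' b"
proof -
  define F where "F = P \<inter> {x. a \<bullet> x = b}"
  define F' where "F' = P' \<inter> {x. a' \<bullet> x = b}"
  have F: "F facet_of P" using facet by (simp add: facet_defining_def F_def)
  have face: "F' face_of P'"
    unfolding F'_def by (rule face_of_Int_supporting_hyperplane_ge) (use conv valid in auto)
  \<comment> \<open>A point of \<open>P\<close> off the facet lifts to a point of \<open>P'\<close>
    off \<open>F'\<close>, so \<open>F'\<close> is a proper face and loses at least one
    dimension.\<close>
  have "F \<noteq> P" using F by auto
  then obtain x where x: "x \<in> P" "a \<bullet> x \<noteq> b" by (auto simp: F_def)
  then have "L x \<in> P'" "L x \<notin> F'" using L by (auto simp: F'_def)
  then have lt: "aff_dim F' < aff_dim P'"
    using face_of_aff_dim_lt[OF conv face] by blast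
  have p_notin: "p \<notin> affine hull (L ` F)"
  proof -
    have "affine hull (L ` F) \<subseteq> {x. g \<bullet> x = 0}"
      by (rule hull_minimal) (use L(3) in \<open>auto simp: F_def affine_hyperplane\<close>)
    then show ?thesis using p(3) by auto
  qed
  have "K ` L ` F = F"
    using K(2) by (force simp: F_def image_image)
  then have "aff_dim F \<le> aff_dim (L ` F)"
    using aff_dim_linear_image_le[OF K(1), of "L ` F"] by simp
  moreover have "aff_dim (insert p (L ` F)) = aff_dim (L ` F) + 1"
    using p_notin by (simp add: aff_dim_insert)
  moreover have "aff_dim (insert p (L ` F)) \<le> aff_dim F'"
    by (rule aff_dim_subset) (use p L in \<open>auto simp: F_def F'_def\<close>)
  moreover have "aff_dim F = aff_dim P - 1" using F by (simp add: facet_of_def)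
  \<comment> \<open>The dimensions are squeezed: \<open>aff_dim F' \<ge> aff_dim F + 1 = aff_dim P
    \<ge> aff_dim P' - 1\<close>, and properness of \<open>F'\<close> bounds it from the other
    side.\<close>
  ultimately have "aff_dim F' = aff_dim P' - 1" using lt dim by linarith
  moreover have "F' \<noteq> {}" using p by (auto simp: F'_def)
  ultimately have "F' facet_of P'" using face by (simp add: facet_of_def)
  then show ?thesis using valid by (simp add: facet_defining_def F'_def)
qed

section \<open>Edge spaces\<close>

lemma inner_incidence: "a \<bullet> incidence F = (\<Sum>e\<in>F. a $ e)"
proof -
  have "a \<bullet> incidence F = (\<Sum>e\<in>UNIV. if e \<in> F then a $ e else 0)"
    unfolding inner_vec_def incidence_def by (rule sum.cong) auto
  then show ?thesis by (simp add: sum.If_cases)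
qed

lemma incidence_in_edge_space: "F \<subseteq> E \<Longrightarrow> incidence F \<in> edge_space E"
  by (auto simp: edge_space_def incidence_def)

lemma convex_edge_space: "convex (edge_space E)"
  by (auto simp: convex_def edge_space_def)

text \<open>Serves as the affine hull in two cases: \<open>T = E \<inter> S\<close> for the
  polytope, because such edges lie in every multicut, and \<open>T = {}\<close> for the
  dominant.\<close>

definition fixed_edge_space :: "'v::finite set set \<Rightarrow> 'v set set \<Rightarrow> (real ^ 'v set) set" where
  "fixed_edge_space E T = {x \<in> edge_space E. \<forall>e\<in>T. x $ e = 1}"

lemma convex_fixed_edge_space: "convex (fixed_edge_space E T)"
  by (auto simp: fixed_edge_space_def convex_def edge_space_def simp flip: distrib_right)

text \<open>Each coordinate outside \<open>T\<close> can be moved on its own from the base point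
  \<open>incidence E\<close>. The step \<open>c\<close> is free because deleting an edge gives -1
  while the dominant allows 1.\<close>

lemma fixed_edge_space_subset_hull:
  fixes P :: "(real ^ 'v::finite set) set"
  assumes "incidence E \<in> P"
    and "\<And>e. e \<in> E - T \<Longrightarrow> \<exists>c. c \<noteq> 0 \<and> incidence E + c *\<^sub>R axis e 1 \<in> P"
    and "T \<subseteq> E"
  shows "fixed_edge_space E T \<subseteq> affine hull P"
proof
  fix x :: "real ^ 'v set" assume x: "x \<in> fixed_edge_space E T"
  \<comment> \<open>The coordinates in \<open>U\<close> already agree with \<open>x\<close>; the
    others still have the value they have in \<open>incidence E\<close>.\<close>
  have "incidence E + (\<Sum>e\<in>U. (x $ e - 1) *\<^sub>R axis e 1) \<in> affine hull P" if "U \<subseteq> E - T" for U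
    using finite[of U] that
  proof (induction U rule: finite_induct)
    case empty
    then show ?case using assms(1) by (simp add: hull_inc)
  next
    case (insert e U)
    then obtain c where c: "c \<noteq> 0" "incidence E + c *\<^sub>R axis e 1 \<in> P" using assms(2) by blast
    let ?y = "incidence E + (\<Sum>e\<in>U. (x $ e - 1) *\<^sub>R axis e 1)"
    have "?y + ((x $ e - 1) / c) *\<^sub>R ((incidence E + c *\<^sub>R axis e 1) - incidence E)
        \<in> affine hull P"
      by (rule mem_affine_3_minus) (use insert c assms(1) in \<open>auto intro: hull_inc\<close>)
    moreover have "((x $ e - 1) / c) *\<^sub>R ((incidence E + c *\<^sub>R axis e 1) - incidence E)
        = (x $ e - 1) *\<^sub>R axis e 1"
      using c by simp
    ultimately show ?case using insert.hyps
      by (simp only: sum.insert[OF insert.hyps] ac_simps)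
  qed
  from this[of "E - T"]
  have "incidence E + (\<Sum>e\<in>E - T. (x $ e - 1) *\<^sub>R axis e 1) \<in> affine hull P" by simp
  also have "incidence E + (\<Sum>e\<in>E - T. (x $ e - 1) *\<^sub>R axis e 1) = x"
  proof (rule vec_eq_iff[THEN iffD2], rule allI)
    fix d
    have "(\<Sum>e\<in>E - T. (x $ e - 1) * axis e 1 $ d) = (\<Sum>e\<in>E - T. if e = d then x $ e - 1 else 0)"
      by (rule sum.cong) (auto simp: axis_def)
    then show "(incidence E + (\<Sum>e\<in>E - T. (x $ e - 1) *\<^sub>R axis e 1)) $ d = x $ d"
      using x assms(3)
      by (auto simp: incidence_def fixed_edge_space_def edge_space_def)
  qed
  finally show "x \<in> affine hull P" .
qed

text \<open>Pullback of coordinates along \<phi>, extended by zero. Both the lift to the split graph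
  and its left inverse are instances.\<close>

definition reindex :: "'v::finite set set \<Rightarrow> ('v set \<Rightarrow> 'v set) \<Rightarrow> real ^ 'v set \<Rightarrow> real ^ 'v set" where
  "reindex T \<phi> x = (\<chi> e. if e \<in> T then x $ \<phi> e else 0)"

lemma reindex_nth: "reindex T \<phi> x $ e = (if e \<in> T then x $ \<phi> e else 0)"
  by (simp add: reindex_def)

lemma linear_reindex: "linear (reindex T \<phi>)"
  by (rule linearI) (auto simp: vec_eq_iff reindex_nth)

lemma reindex_incidence: "reindex T \<phi> (incidence \<delta>) = incidence {e \<in> T. \<phi> e \<in> \<delta>}"
  by (auto simp: vec_eq_iff reindex_nth incidence_def)

lemma inner_reindex:
  assumes "bij_betw \<phi> T E" "x \<in> edge_space E"
  shows "reindex T \<phi> a \<bullet> reindex T \<phi> x = a \<bullet> x"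
proof -
  have "reindex T \<phi> a \<bullet> reindex T \<phi> x = (\<Sum>e\<in>UNIV. if e \<in> T then a $ \<phi> e * x $ \<phi> e else 0)"
    unfolding inner_vec_def by (rule sum.cong) (auto simp: reindex_nth)
  also have "\<dots> = (\<Sum>e\<in>T. a $ \<phi> e * x $ \<phi> e)" by (simp add: sum.If_cases)
  also have "\<dots> = (\<Sum>e\<in>E. a $ e * x $ e)" by (rule sum.reindex_bij_betw[OF assms(1)])
  also have "\<dots> = (\<Sum>e\<in>UNIV. a $ e * x $ e)"
    by (rule sum.mono_neutral_left) (use assms(2) in \<open>auto simp: edge_space_def\<close>)
  finally show ?thesis by (simp add: inner_vec_def)
qed

section \<open>Multicuts\<close>

lemma sym_adj: "sym (adj F)"
  by (auto simp: adj_def sym_def insert_commute)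

lemma component_eq_iff:
  assumes "s \<in> V" "t \<in> V"
  shows "component V F s = component V F t \<longleftrightarrow> (s, t) \<in> (adj F)\<^sup>*"
proof
  have "t \<in> component V F t" using assms by (simp add: component_def)
  moreover assume "component V F s = component V F t"
  ultimately show "(s, t) \<in> (adj F)\<^sup>*" by (auto simp: component_def)
next
  assume *: "(s, t) \<in> (adj F)\<^sup>*"
  then have "(t, s) \<in> (adj F)\<^sup>*" using sym_rtrancl[OF sym_adj] by (meson symD)
  with * show "component V F s = component V F t"
    by (auto simp: component_def intro: rtrancl_trans)
qed

text \<open>Pairs of \<open>S\<close> lie in \<open>V\<close>, where two components coincide exactly
  when the nodes are joined by a walk. All later arguments are about walks.\<close>

lemma multicut_iff:
  assumes "S \<subseteq> node_pairs V"
  shows "multicut V E S \<delta> \<longleftrightarrow>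
    \<delta> \<subseteq> E \<and> (\<forall>s t. {s, t} \<in> S \<longrightarrow> (s, t) \<notin> (adj (E - \<delta>))\<^sup>*)"
proof -
  have "s \<in> V" "t \<in> V" if "{s, t} \<in> S" for s t using that assms by (auto simp: node_pairs_def)
  then show ?thesis unfolding multicut_def by (simp add: component_eq_iff cong: imp_cong)
qed

text \<open>Only the remaining edges matter, and fewer of them connect fewer pairs. The edge set may
  change as well, which allows passing to the split graph without its new edge.\<close>

lemma multicut_mono:
  assumes "S \<subseteq> node_pairs V" "multicut V E S \<delta>" "\<delta>' \<subseteq> E'" "E' - \<delta>' \<subseteq> E - \<delta>"
  shows "multicut V E' S \<delta>'"
proof -
  have "adj (E' - \<delta>') \<subseteq> adj (E - \<delta>)" using assms(4) by (auto simp: adj_def)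
  then have "(adj (E' - \<delta>'))\<^sup>* \<subseteq> (adj (E - \<delta>))\<^sup>*" by (rule rtrancl_mono)
  then show ?thesis using assms by (auto simp: multicut_iff)
qed

lemma multicut_edges:
  assumes "S \<subseteq> node_pairs V"
  shows "multicut V E S E"
proof -
  have "s = t" if "(s, t) \<in> (adj ({} :: 'a set set))\<^sup>*" for s t
    using that by (simp add: adj_def)
  moreover have "s \<noteq> t" if "{s, t} \<in> S" for s t using that assms by (auto simp: node_pairs_def)
  ultimately show ?thesis by (auto simp: multicut_iff[OF assms])
qed

text \<open>The one remaining edge connects only its own two ends, and these do not form a pair of
  \<open>S\<close>.\<close>

lemma multicut_edges_minus:
  assumes "S \<subseteq> node_pairs V" "E \<subseteq> node_pairs V" "e \<in> E - S"
  shows "multicut V E S (E - {e})"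
proof -
  have e: "E - (E - {e}) = {e}" "card e = 2" using assms by (auto simp: node_pairs_def)
  have *: "s = t \<or> (s \<in> e \<and> t \<in> e)" if "(s, t) \<in> (adj {e})\<^sup>*" for s t
    using that by (induction rule: rtrancl_induct) (auto simp: adj_def)
  have "(s, t) \<notin> (adj {e})\<^sup>*" if st: "{s, t} \<in> S" for s t
  proof
    assume "(s, t) \<in> (adj {e})\<^sup>*"
    moreover have "card {s, t} = 2" using st assms by (auto simp: node_pairs_def)
    ultimately have "{s, t} \<subseteq> e" "card {s, t} = card e" using * e by (fastforce)+
    then have "{s, t} = e" using card_subset_eq[of e "{s, t}"] e(2)
      by (metis card.infinite zero_neq_numeral)
    with st assms(3) show False by simp
  qed
  then show ?thesis by (auto simp: multicut_iff[OF assms(1)] e)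
qed

text \<open>If left uncut, such an edge would itself be a walk joining its pair.\<close>

lemma multicut_pair_mem:
  assumes "S \<subseteq> node_pairs V" "multicut V E S \<delta>" "e \<in> E \<inter> S"
  shows "e \<in> \<delta>"
proof (rule ccontr)
  assume "e \<notin> \<delta>"
  obtain s t where st: "e = {s, t}"
    using assms by (auto simp: node_pairs_def card_2_iff)
  then have "(s, t) \<in> adj (E - \<delta>)" using assms(3) \<open>e \<notin> \<delta>\<close> by (simp add: adj_def)
  then have "(s, t) \<in> (adj (E - \<delta>))\<^sup>*" by (rule r_into_rtrancl)
  then show False using assms st by (auto simp: multicut_iff[OF assms(1)])
qed

section \<open>Multicut polytope and dominant: convexity, affine hulls, signs of
  coefficients\<close>

lemma incidence_in_polytope: "multicut V E S \<delta> \<Longrightarrow> incidence \<delta> \<in> multicut_polytope V E S"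
  by (auto simp: multicut_polytope_def intro: hull_inc)

lemma multicut_polytope_subset:
  assumes "convex C" "\<And>\<delta>. multicut V E S \<delta> \<Longrightarrow> incidence \<delta> \<in> C"
  shows "multicut_polytope V E S \<subseteq> C"
  unfolding multicut_polytope_def by (rule hull_minimal) (use assms in auto)

lemma multicut_polytope_subset_edge_space: "multicut_polytope V E S \<subseteq> edge_space E"
  by (rule multicut_polytope_subset[OF convex_edge_space])
     (auto simp: multicut_def intro: incidence_in_edge_space)

lemma multicut_dominantI:
  "x \<in> multicut_polytope V E S \<Longrightarrow> y \<in> edge_space E \<Longrightarrow> (\<And>e. y $ e \<ge> 0)
    \<Longrightarrow> x + y \<in> multicut_dominant V E S"
  by (auto simp: multicut_dominant_def)

lemma multicut_dominantE:
  assumes "z \<in> multicut_dominant V E S"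
  obtains x y where "z = x + y" "x \<in> multicut_polytope V E S" "y \<in> edge_space E" "\<And>e. y $ e \<ge> 0"
  using assms by (auto simp: multicut_dominant_def)

lemma polytope_subset_dominant: "multicut_polytope V E S \<subseteq> multicut_dominant V E S"
  using multicut_dominantI[of _ V E S 0] by (auto simp: edge_space_def)

lemma convex_multicut_dominant: "convex (multicut_dominant V E S)"
proof -
  have "convex {y \<in> edge_space E. \<forall>e. y $ e \<ge> 0}"
    by (auto simp: convex_def edge_space_def)
  then have "convex (\<Union>x\<in>multicut_polytope V E S. \<Union>y\<in>{y \<in> edge_space E. \<forall>e. y $ e \<ge> 0}. {x + y})"
    by (intro convex_sums) (auto simp: multicut_polytope_def)
  moreover have "multicut_dominant V E S =
      (\<Union>x\<in>multicut_polytope V E S. \<Union>y\<in>{y \<in> edge_space E. \<forall>e. y $ e \<ge> 0}. {x + y})"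
    by (auto simp: multicut_dominant_def)
  ultimately show ?thesis by simp
qed

lemma multicut_dominant_subset_edge_space: "multicut_dominant V E S \<subseteq> edge_space E"
  using multicut_polytope_subset_edge_space[of V E S]
  by (fastforce simp: multicut_dominant_def edge_space_def)

lemma fixed_edge_space_subset_polytope_hull:
  assumes "S \<subseteq> node_pairs V" "E \<subseteq> node_pairs V"
  shows "fixed_edge_space E (E \<inter> S) \<subseteq> affine hull (multicut_polytope V E S)"
proof (rule fixed_edge_space_subset_hull)
  show "incidence E \<in> multicut_polytope V E S"
    by (rule incidence_in_polytope[OF multicut_edges[OF assms(1)]])
next
  fix e assume e: "e \<in> E - E \<inter> S"
  \<comment> \<open>Deleting \<open>e\<close> from the full cut is the move by -1 in coordinate
    \<open>e\<close>.\<close>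
  have "incidence E + (-1) *\<^sub>R axis e 1 = incidence (E - {e})"
    using e by (auto simp: vec_eq_iff incidence_def axis_def)
  moreover have "incidence (E - {e}) \<in> multicut_polytope V E S"
    using e assms by (intro incidence_in_polytope multicut_edges_minus) auto
  ultimately have "(-1::real) \<noteq> 0 \<and> incidence E + (-1) *\<^sub>R axis e 1 \<in> multicut_polytope V E S"
    by simp
  then show "\<exists>c. c \<noteq> 0 \<and> incidence E + c *\<^sub>R axis e 1 \<in> multicut_polytope V E S" by blast
qed simp

lemma incidence_plus_axis_in_dominant:
  assumes "S \<subseteq> node_pairs V" "e \<in> E" "c \<ge> 0"
  shows "incidence E + c *\<^sub>R axis e 1 \<in> multicut_dominant V E S"
  by (rule multicut_dominantI[OF incidence_in_polytope[OF multicut_edges[OF assms(1)]]])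
     (use assms in \<open>auto simp: edge_space_def axis_def\<close>)

lemma edge_space_subset_dominant_hull:
  assumes "S \<subseteq> node_pairs V"
  shows "fixed_edge_space E {} \<subseteq> affine hull (multicut_dominant V E S)"
proof (rule fixed_edge_space_subset_hull)
  show "incidence E \<in> multicut_dominant V E S"
    using incidence_in_polytope[OF multicut_edges[OF assms]] polytope_subset_dominant by blast
next
  fix e assume e: "e \<in> E - {}"
  then have "(1::real) \<noteq> 0 \<and> incidence E + 1 *\<^sub>R axis e 1 \<in> multicut_dominant V E S"
    by (metis Diff_empty assms incidence_plus_axis_in_dominant zero_le_one zero_neq_one)
  then show "\<exists>c. c \<noteq> 0 \<and> incidence E + c *\<^sub>R axis e 1 \<in> multicut_dominant V E S" by blast
qed simp

text \<open>The dominant contains a ray in direction \<open>e\<close>, along which a negative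
  coefficient would push the value below any bound.\<close>

lemma valid_dominant_nonneg:
  assumes "S \<subseteq> node_pairs V" "\<And>x. x \<in> multicut_dominant V E S \<Longrightarrow> a \<bullet> x \<ge> b" "e \<in> E"
  shows "a $ e \<ge> 0"
proof (rule ccontr)
  assume neg: "\<not> a $ e \<ge> 0"
  \<comment> \<open>This step length lowers the value at \<open>incidence E\<close> by its distance
    from \<open>b\<close> plus 1, hence strictly below \<open>b\<close>.\<close>
  define c where "c = (\<bar>b - a \<bullet> incidence E\<bar> + 1) / (- (a $ e))"
  have c: "c \<ge> 0" "c * a $ e = - (\<bar>b - a \<bullet> incidence E\<bar> + 1)"
    using neg by (auto simp: c_def divide_simps)
  have "b \<le> a \<bullet> (incidence E + c *\<^sub>R axis e 1)"
    by (rule assms(2)[OF incidence_plus_axis_in_dominant]) (use assms c in auto)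
  also have "\<dots> = a \<bullet> incidence E + c * a $ e"
    by (simp add: inner_add_right inner_axis)
  finally show False using c(2) by linarith
qed

section \<open>Splitting a node\<close>

locale node_split =
  fixes V :: "'v::finite set" and E S :: "'v set set" and v v1 v2 :: 'v
    and h :: "'v \<Rightarrow> 'v" and R :: "'v \<Rightarrow> 'v set set"
  assumes E: "E \<subseteq> node_pairs V" and S: "S \<subseteq> node_pairs V"
    and v: "v \<in> V" and v1: "v1 \<notin> V" and v2: "v2 \<notin> V" and v12: "v1 \<noteq> v2"
    and h: "\<And>w. {v, w} \<in> E \<Longrightarrow> h w \<in> {v1, v2}"
    and R: "\<And>t. {v, t} \<in> S \<Longrightarrow> R t \<subseteq> {{v1, t}, {v2, t}} \<and> R t \<noteq> {}"
begin

abbreviation "f \<equiv> {v1, v2}"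
abbreviation "V' \<equiv> split_nodes v v1 v2 V"
abbreviation "E' \<equiv> split_edges v v1 v2 h E"
abbreviation "S' \<equiv> split_pairs v R S"
abbreviation "\<phi> \<equiv> unsplit_edge v v1 v2"
text \<open>The map \<phi> identifies \<open>T\<close> with \<open>E\<close>, and \<psi> inverts it;
  \<open>L\<close> and \<open>K\<close> are the induced maps on vectors, with \<open>L x\<close>
  zero at \<open>f\<close>.\<close>

abbreviation "T \<equiv> E' - {f}"
abbreviation "\<psi> \<equiv> inv_into T \<phi>"
abbreviation "L \<equiv> reindex T \<phi>"
abbreviation "K \<equiv> reindex E \<psi>"

text \<open>Contraction of \<open>v1v2\<close> on nodes. It also fixes \<open>v\<close>, which is no
  node of the split graph; hence the side conditions \<open>x \<noteq> v\<close> when preimages are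
  chosen.\<close>

definition merge :: "'v \<Rightarrow> 'v" where
  "merge x = (if x \<in> {v1, v2} then v else x)"

section \<open>The edge bijection and the contraction of nodes\<close>

lemma node_pair_mem:
  assumes "{v, w} \<in> node_pairs V"
  shows "w \<in> V" "w \<noteq> v" "w \<noteq> v1" "w \<noteq> v2"
  using assms v1 v2 by (auto simp: node_pairs_def)

lemma T_cases:
  assumes "e \<in> T"
  obtains "e \<in> E" "v \<notin> e" "v1 \<notin> e" "v2 \<notin> e"
  | w where "{v, w} \<in> E" "e = {h w, w}" "h w \<in> {v1, v2}" "w \<in> V" "w \<noteq> v" "w \<noteq> v1" "w \<noteq> v2"
proof -
  consider "e \<in> E" "v \<notin> e" | w where "{v, w} \<in> E" "e = {h w, w}"
    using assms by (auto simp: split_edges_def)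
  then show thesis
  proof cases
    case 1
    then show thesis using that(1) E v1 v2 by (auto simp: node_pairs_def)
  next
    case (2 w)
    then show thesis using that(2)[of w] node_pair_mem[of w] h E by auto
  qed
qed

lemma f_mem: "f \<in> E'"
  by (simp add: split_edges_def)

lemma kept_edge: "e \<in> E \<Longrightarrow> v \<notin> e \<Longrightarrow> e \<in> T \<and> \<phi> e = e"
  using E v1 v2 by (auto simp: split_edges_def unsplit_edge_def node_pairs_def)

lemma moved_edge:
  assumes "{v, w} \<in> E"
  shows "{h w, w} \<in> T" "\<phi> {h w, w} = {v, w}"
proof -
  have w: "w \<in> V" "w \<noteq> v" "w \<noteq> v1" "w \<noteq> v2" "h w \<in> {v1, v2}"
    using node_pair_mem[of w] assms E h by auto
  then have "{h w, w} \<noteq> f" by auto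
  then show "{h w, w} \<in> T" using assms by (auto simp: split_edges_def)
  show "\<phi> {h w, w} = {v, w}" using w by (auto simp: unsplit_edge_def)
qed

text \<open>Links the edge map to the node map, so that contracting a walk node by node also maps
  its edges by \<phi>.\<close>

lemma \<phi>_image_merge: "e \<in> T \<Longrightarrow> \<phi> e = merge ` e"
  by (erule T_cases) (auto simp: unsplit_edge_def merge_def)

lemma \<phi>_mem: "e \<in> T \<Longrightarrow> \<phi> e \<in> E"
  by (metis T_cases kept_edge moved_edge(2))

text \<open>Membership of \<open>v\<close> in the image tells moved edges from kept ones, and a
  moved edge is recovered from its other end \<open>w\<close> because \<open>h\<close> attaches
  \<open>w\<close> to one copy only.\<close>

lemma bij_\<phi>: "bij_betw \<phi> T E"
proof (rule bij_betw_imageI)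
  show "inj_on \<phi> T"
  proof (rule inj_onI)
    fix e e' assume "e \<in> T" "e' \<in> T" and eq: "\<phi> e = \<phi> e'"
    then show "e = e'"
    proof (cases e rule: T_cases)
      case 1
      then have "\<phi> e = e" "v \<notin> \<phi> e" using kept_edge by auto
      from \<open>e' \<in> T\<close> show ?thesis
      proof (cases e' rule: T_cases)
        case 1
        then show ?thesis using kept_edge \<open>\<phi> e = e\<close> eq by auto
      next
        case (2 w)
        then show ?thesis using moved_edge(2)[of w] eq \<open>v \<notin> \<phi> e\<close> by auto
      qed
    next
      case (2 w)
      note w = this
      from \<open>e' \<in> T\<close> show ?thesis
      proof (cases e' rule: T_cases)
        case 1
        then show ?thesis using kept_edge[of e'] w moved_edge(2)[of w] eq by auto
      next
        case (2 w')
        then have "{v, w} = {v, w'}" using w eq moved_edge(2)[of w] moved_edge(2)[of w'] by auto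
        then have "w = w'" using w 2 by (auto simp: doubleton_eq_iff)
        then show ?thesis using w 2 by simp
      qed
    qed
  qed
  show "\<phi> ` T = E"
  proof
    show "\<phi> ` T \<subseteq> E" using \<phi>_mem by auto
    show "E \<subseteq> \<phi> ` T"
    proof
      fix e assume e: "e \<in> E"
      show "e \<in> \<phi> ` T"
      proof (cases "v \<in> e")
        case False
        then show ?thesis using kept_edge[OF e] by (metis imageI)
      next
        case True
        then obtain w where "e = {v, w}"
          using e E by (auto simp: node_pairs_def card_2_iff)
        then show ?thesis using moved_edge[of w] e by (metis imageI)
      qed
    qed
  qed
qed

lemma \<psi>: "e \<in> E \<Longrightarrow> \<psi> e \<in> T \<and> \<phi> (\<psi> e) = e"
  using bij_\<phi> by (metis bij_betw_imp_surj_on f_inv_into_f inv_into_into)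

lemma \<psi>_\<phi>: "e \<in> T \<Longrightarrow> \<psi> (\<phi> e) = e"
  using bij_\<phi> by (simp add: bij_betw_imp_inj_on)

section \<open>Multicuts under splitting and contraction\<close>

lemma S'_merge:
  assumes "{s, t} \<in> S'"
  shows "{merge s, merge t} \<in> S"
proof -
  consider "{s, t} \<in> S" "v \<notin> {s, t}" | u where "{v, u} \<in> S" "{s, t} \<in> R u"
    using assms by (auto simp: split_pairs_def)
  then show ?thesis
  proof cases
    case 1
    then show ?thesis using S v1 v2 by (auto simp: merge_def node_pairs_def)
  next
    case (2 u)
    then have u: "u \<noteq> v1" "u \<noteq> v2" using node_pair_mem[of u] S by auto
    have "{s, t} = {v1, u} \<or> {s, t} = {v2, u}" using R 2 by auto
    then have "merge ` {s, t} = {v, u}"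
      using u by (auto simp: merge_def)
    then show ?thesis using 2 by simp
  qed
qed

lemma S'_node_pairs: "S' \<subseteq> node_pairs V'"
proof
  fix p assume "p \<in> S'"
  then consider "p \<in> S" "v \<notin> p" | u where "{v, u} \<in> S" "p \<in> R u"
    by (auto simp: split_pairs_def)
  then show "p \<in> node_pairs V'"
  proof cases
    case 1
    then show ?thesis using S by (auto simp: node_pairs_def split_nodes_def)
  next
    case (2 u)
    then have u: "u \<in> V" "u \<noteq> v" "u \<noteq> v1" "u \<noteq> v2" using node_pair_mem[of u] S by auto
    have "p = {v1, u} \<or> p = {v2, u}" using R 2 by auto
    then show ?thesis using u by (auto simp: node_pairs_def split_nodes_def)
  qed
qed

text \<open>A walk avoiding the lifted cut contracts to a walk avoiding \<delta>, and pairs of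
  \<open>S'\<close> contract to pairs of \<open>S\<close>. The new edge can stay uncut.\<close>

lemma multicut_lift:
  assumes "multicut V E S \<delta>"
  shows "multicut V' E' S' {e \<in> T. \<phi> e \<in> \<delta>}"
proof -
  let ?\<delta> = "{e \<in> T. \<phi> e \<in> \<delta>}"
  have step: "(merge x, merge y) \<in> (adj (E - \<delta>))\<^sup>*" if "(x, y) \<in> adj (E' - ?\<delta>)" for x y
  \<comment> \<open>The new edge collapses to the single node \<open>v\<close>, so its image is the
    empty walk.\<close>
  proof (cases "{x, y} = f")
    case True
    then have "merge x = merge y" by (auto simp: doubleton_eq_iff merge_def)
    then show ?thesis by simp
  next
    case False
    then have xy: "{x, y} \<in> T" "\<phi> {x, y} \<notin> \<delta>" using that by (auto simp: adj_def)
    then have "{merge x, merge y} \<in> E - \<delta>"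
      using \<phi>_mem[OF xy(1)] \<phi>_image_merge[OF xy(1)] by simp
    then show ?thesis by (auto simp: adj_def)
  qed
  have walk: "(merge x, merge y) \<in> (adj (E - \<delta>))\<^sup>*" if "(x, y) \<in> (adj (E' - ?\<delta>))\<^sup>*" for x y
    using that by (induction rule: rtrancl_induct) (use step in \<open>auto intro: rtrancl_trans\<close>)
  have sep: "(s, t) \<notin> (adj (E - \<delta>))\<^sup>*" if "{s, t} \<in> S" for s t
    using assms that by (simp add: multicut_iff[OF S])
  have "(s, t) \<notin> (adj (E' - ?\<delta>))\<^sup>*" if "{s, t} \<in> S'" for s t
    using sep[OF S'_merge[OF that]] walk by blast
  then show ?thesis
    unfolding multicut_iff[OF S'_node_pairs] by blast
qed

text \<open>Since \<open>v1v2\<close> is uncut, both copies of \<open>v\<close> are connected, and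
  every walk avoiding the contracted cut lifts to a walk avoiding \<delta>. A violated pair of
  \<open>S\<close> then yields a violated pair of \<open>S'\<close>.\<close>

lemma multicut_push:
  assumes \<delta>: "multicut V' E' S' \<delta>" and f: "f \<notin> \<delta>"
  shows "multicut V E S (\<phi> ` \<delta>)"
proof -
  let ?A = "(adj (E' - \<delta>))\<^sup>*"
  have sub: "\<delta> \<subseteq> T" using \<delta> f by (auto simp: multicut_def)
  have sym: "(y, x) \<in> ?A" if "(x, y) \<in> ?A" for x y
    using that sym_rtrancl[OF sym_adj] by (meson symD)
  have v1_v2: "(v1, v2) \<in> ?A" using f f_mem by (auto simp: adj_def)
  \<comment> \<open>Apart from \<open>v\<close> itself, the only distinct nodes with equal image are
    \<open>v1\<close> and \<open>v2\<close>, which the uncut new edge joins.\<close>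
  then have merge_A: "(x, y) \<in> ?A" if "merge x = merge y" "x \<noteq> v" "y \<noteq> v" for x y
    using that v1_v2 sym[OF v1_v2] by (auto simp: merge_def split: if_splits)
  \<comment> \<open>The edge lifts by \<psi>, but its ends may be other preimages than
    \<open>x'\<close> and \<open>y'\<close>; the gaps are closed by \<open>merge_A\<close>.\<close>
  have edge: "(x', y') \<in> ?A"
    if xy: "(x, y) \<in> adj (E - \<phi> ` \<delta>)" and m: "merge x' = x" "merge y' = y" "x' \<noteq> v" "y' \<noteq> v"
    for x y x' y'
  proof -
    have "{x, y} \<in> E" "{x, y} \<notin> \<phi> ` \<delta>" using xy by (auto simp: adj_def)
    define e where "e = \<psi> {x, y}"
    have e: "e \<in> T" "\<phi> e = {x, y}"
      using \<psi>[OF \<open>{x, y} \<in> E\<close>] by (simp_all add: e_def)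
    then have "e \<notin> \<delta>" using \<open>{x, y} \<notin> \<phi> ` \<delta>\<close> by (metis imageI)
    have "v \<notin> e" using e(1) v v1 v2 by (cases e rule: T_cases) auto
    have "merge ` e = {x, y}" using e \<phi>_image_merge by simp
    moreover obtain r s where rs: "e = {r, s}"
      using e(1)
    proof (cases e rule: T_cases)
      case 1
      then show ?thesis using E that by (auto simp: node_pairs_def card_2_iff)
    next
      case (2 w)
      then show ?thesis using that by blast
    qed
    ultimately have "(merge r = x \<and> merge s = y) \<or> (merge s = x \<and> merge r = y)"
      by (simp add: doubleton_eq_iff conj_commute)
    then obtain p q where pq: "e = {p, q}" "merge p = x" "merge q = y"
      using rs that[of r s] that[of s r] by (auto simp: insert_commute)
    have "(p, q) \<in> ?A" using e(1) \<open>e \<notin> \<delta>\<close> pq(1) by (auto simp: adj_def)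
    moreover have "(x', p) \<in> ?A" "(q, y') \<in> ?A"
      using merge_A[of x' p] merge_A[of q y'] m pq \<open>v \<notin> e\<close> by auto
    ultimately show ?thesis by (meson rtrancl_trans)
  qed
  have lift: "\<exists>x'. merge x' = x \<and> x' \<noteq> v" if "x \<in> V" for x
  proof (cases "x = v")
    case True
    then have "merge v1 = x" "v1 \<noteq> v" using v v1 by (auto simp: merge_def)
    then show ?thesis by blast
  next
    case False
    then have "merge x = x" using that v1 v2 by (auto simp: merge_def)
    then show ?thesis using False by blast
  qed
  \<comment> \<open>The claim covers all preimages of the end node, so the induction hypothesis
    applies to whichever preimage \<open>u\<close> of the intermediate node is picked.\<close>
  have walk: "(x', y') \<in> ?A"
    if "(x, y) \<in> (adj (E - \<phi> ` \<delta>))\<^sup>*" "merge x' = x" "merge y' = y" "x' \<noteq> v" "y' \<noteq> v"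
    for x y x' y'
    using that
  proof (induction arbitrary: y' rule: rtrancl_induct)
    case base
    then show ?case using merge_A by auto
  next
    case (step y z)
    have "y \<in> V" using step.hyps(2) E by (auto simp: adj_def node_pairs_def)
    then obtain u where u: "merge u = y" "u \<noteq> v" using lift by auto
    have "(x', u) \<in> ?A" by (rule step.IH) (use step.prems u in auto)
    moreover have "(u, y') \<in> ?A" by (rule edge[OF step.hyps(2)]) (use step.prems u in auto)
    ultimately show ?case by (rule rtrancl_trans)
  qed
  have sep: "(s, t) \<notin> ?A" if "{s, t} \<in> S'" for s t
    using \<delta> that by (simp add: multicut_iff[OF S'_node_pairs])
  have "(s, t) \<notin> (adj (E - \<phi> ` \<delta>))\<^sup>*" if st: "{s, t} \<in> S" for s t
  proof
    assume c: "(s, t) \<in> (adj (E - \<phi> ` \<delta>))\<^sup>*"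
    have "\<exists>s' t'. merge s' = s \<and> merge t' = t \<and> s' \<noteq> v \<and> t' \<noteq> v \<and> {s', t'} \<in> S'"
    proof -
      \<comment> \<open>Here nonemptiness of \<open>R t\<close> is essential: at least one copy of
        \<open>v\<close> must still be separated from \<open>t\<close>.\<close>
      have lift_v: "\<exists>v'. merge v' = v \<and> merge t = t \<and> v' \<noteq> v \<and> t \<noteq> v \<and> {v', t} \<in> S'"
        if "{v, t} \<in> S" for t
      proof -
        have t: "t \<noteq> v" "t \<noteq> v1" "t \<noteq> v2" using node_pair_mem[of t] that S by auto
        have "{v1, t} \<in> R t \<or> {v2, t} \<in> R t" using R[OF that] by blast
        then obtain v' where "v' \<in> {v1, v2}" "{v', t} \<in> R t" by blast
        moreover from this have "{v', t} \<in> S'"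
          unfolding split_pairs_def using that by blast
        moreover have "merge v' = v" "merge t = t" "v' \<noteq> v"
          using t v v1 v2 \<open>v' \<in> {v1, v2}\<close> by (auto simp: merge_def)
        ultimately show ?thesis using t by blast
      qed
      consider "s = v" | "t = v" | "v \<notin> {s, t}" by auto
      then show ?thesis
      proof cases
        case 1
        then show ?thesis using lift_v[of t] st by blast
      next
        case 2
        then have "{v, s} \<in> S" using st by (simp add: insert_commute)
        from lift_v[OF this]
        obtain s' where "merge s' = v" "merge s = s" "s' \<noteq> v" "s \<noteq> v" "{s', s} \<in> S'"
          by blast
        moreover from this have "{s, s'} \<in> S'" by (simp add: insert_commute)
        ultimately show ?thesis unfolding 2 by blast
      next
        case 3
        then have "{s, t} \<in> S'" using st by (auto simp: split_pairs_def)
        moreover have "merge s = s" "merge t = t"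
          using st S v1 v2 by (auto simp: merge_def node_pairs_def)
        ultimately show ?thesis using 3 by blast
      qed
    qed
    then obtain s' t' where "merge s' = s" "merge t' = t" "s' \<noteq> v" "t' \<noteq> v" "{s', t'} \<in> S'"
      by (elim exE conjE)
    then show False using walk[OF c, of s' t'] sep[of s' t'] by simp
  qed
  moreover have "\<phi> ` \<delta> \<subseteq> E" using sub \<phi>_mem by blast
  ultimately show ?thesis
    unfolding multicut_iff[OF S] by blast
qed

text \<open>Cutting \<open>f\<close> and deleting \<open>f\<close> leave the same remaining edges.
  This ties cuts containing \<open>f\<close> to the minimum that defines the new
  coefficient.\<close>

lemma multicut_delete_edge:
  "f \<in> \<delta> \<Longrightarrow> multicut V' E' S' \<delta> \<longleftrightarrow> \<delta> \<subseteq> E' \<and> multicut V' T S' (\<delta> - {f})"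
proof -
  assume "f \<in> \<delta>"
  then have "T - (\<delta> - {f}) = E' - \<delta>" by auto
  then show ?thesis using \<open>f \<in> \<delta>\<close> by (auto simp: multicut_def)
qed

section \<open>Lifting points and comparing dimensions\<close>

lemma K_L: "x \<in> edge_space E \<Longrightarrow> K (L x) = x"
  by (auto simp: vec_eq_iff reindex_nth \<psi> edge_space_def)
     (use \<psi> in auto)

text \<open>Apart from coordinate \<open>f\<close>, every vector comes from \<open>E\<close>. The
  hypothesis ensures that coordinates fixed in \<open>E\<close> stay fixed after the splitting, so
  \<open>f\<close> accounts for all of the growth.\<close>

lemma aff_dim_fixed_edge_space:
  assumes "\<And>e. e \<in> U \<Longrightarrow> e \<in> E \<and> \<psi> e \<in> U'"
  shows "aff_dim (fixed_edge_space E' U') \<le> aff_dim (fixed_edge_space E U) + 1"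
proof (rule aff_dim_le_Suc)
  show "linear L" by (rule linear_reindex)
  show "fixed_edge_space E U \<noteq> {}"
    using incidence_in_edge_space[of E E] assms by (force simp: fixed_edge_space_def incidence_def)
next
  fix x assume x: "x \<in> fixed_edge_space E' U'"
  have "K x \<in> fixed_edge_space E U"
    using x assms by (auto simp: fixed_edge_space_def edge_space_def reindex_nth)
  moreover have "x = L (K x) + (x $ f) *\<^sub>R axis f 1"
    using x \<phi>_mem \<psi>_\<phi>
    by (auto simp: vec_eq_iff reindex_nth fixed_edge_space_def edge_space_def axis_def)
  ultimately show "\<exists>y\<in>fixed_edge_space E U. \<exists>c. x = L y + c *\<^sub>R axis f 1" by blast
qed

lemma L_polytope: "x \<in> multicut_polytope V E S \<Longrightarrow> L x \<in> multicut_polytope V' E' S'"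
proof -
  have "L ` multicut_polytope V E S \<subseteq> multicut_polytope V' E' S'"
    unfolding multicut_polytope_def[of V E S] convex_hull_linear_image[OF linear_reindex]
      multicut_polytope_def[of V' E' S']
    by (rule hull_mono) (use multicut_lift in \<open>force simp: reindex_incidence\<close>)
  then show "x \<in> multicut_polytope V E S \<Longrightarrow> L x \<in> multicut_polytope V' E' S'" by auto
qed

lemma L_dominant:
  assumes "x \<in> multicut_dominant V E S"
  shows "L x \<in> multicut_dominant V' E' S'"
  using assms
proof (rule multicut_dominantE)
  fix y z assume x: "x = y + z" "y \<in> multicut_polytope V E S" "z \<in> edge_space E" "\<And>e. z $ e \<ge> 0"
  have "L x = L y + L z" unfolding x(1) by (rule linear_add[OF linear_reindex])
  also have "\<dots> \<in> multicut_dominant V' E' S'"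
    by (rule multicut_dominantI) (use x L_polytope in \<open>auto simp: reindex_nth edge_space_def\<close>)
  finally show ?thesis .
qed

section \<open>The split inequality: coefficients and validity\<close>

context
  fixes a :: "real ^ 'v set" and b :: real
  assumes facet: "facet_defining (multicut_dominant V E S) a b"
begin

abbreviation "\<omega> \<equiv> min_multicut_weight V' T S' (\<lambda>e. a $ \<phi> e)"

definition split_coeffs :: "real ^ 'v set" where
  "split_coeffs = L a + (b - \<omega>) *\<^sub>R axis f 1"

lemma valid: "x \<in> multicut_dominant V E S \<Longrightarrow> a \<bullet> x \<ge> b"
  using facet by (simp add: facet_defining_def)

lemma \<omega>_le: "multicut V' T S' \<delta> \<Longrightarrow> \<omega> \<le> (\<Sum>e\<in>\<delta>. a $ \<phi> e)"
  unfolding min_multicut_weight_def by (rule Min_le) auto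

lemma \<omega>_attained: "\<exists>\<delta>. multicut V' T S' \<delta> \<and> \<omega> = (\<Sum>e\<in>\<delta>. a $ \<phi> e)"
proof -
  have "\<omega> \<in> (\<lambda>\<delta>. \<Sum>e\<in>\<delta>. a $ \<phi> e) ` {\<delta>. multicut V' T S' \<delta>}"
    unfolding min_multicut_weight_def
    by (rule Min_in) (use multicut_edges[OF S'_node_pairs] in auto)
  then show ?thesis by auto
qed

lemma split_coeffs_L:
  assumes "x \<in> edge_space E"
  shows "split_coeffs \<bullet> L x = a \<bullet> x"
  using inner_reindex[OF bij_\<phi> assms, of a]
  by (simp add: split_coeffs_def inner_add_left inner_axis' reindex_nth)

lemma split_coeffs_incidence:
  assumes "\<delta> \<subseteq> E'"
  shows "split_coeffs \<bullet> incidence \<delta>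
    = (\<Sum>e\<in>\<delta> - {f}. a $ \<phi> e) + (if f \<in> \<delta> then b - \<omega> else 0)"
proof -
  have "L a \<bullet> incidence \<delta> = (\<Sum>e\<in>\<delta>. if e \<in> T then a $ \<phi> e else 0)"
    by (simp add: inner_incidence reindex_nth)
  also have "\<dots> = (\<Sum>e\<in>\<delta> \<inter> T. a $ \<phi> e)" by (simp add: sum.inter_restrict)
  also have "\<delta> \<inter> T = \<delta> - {f}" using assms by auto
  finally show ?thesis
    by (simp add: split_coeffs_def inner_add_left inner_axis' incidence_def)
qed

lemma a_nonneg: "e \<in> E \<Longrightarrow> a $ e \<ge> 0"
  by (rule valid_dominant_nonneg[OF S valid])

text \<open>Each multicut of the original graph lifts to one of equal weight in the split graph
  without \<open>f\<close>, so \<omega> bounds \<open>a\<close> from below on the polytope. This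
  makes the coefficient of \<open>f\<close> nonnegative, as validity on the dominant
  demands.\<close>

lemma \<omega>_le_b: "\<omega> \<le> b"
proof -
  have "\<omega> \<le> a \<bullet> incidence \<delta>" if "multicut V E S \<delta>" for \<delta>
  proof -
    let ?\<delta> = "{e \<in> T. \<phi> e \<in> \<delta>}"
    have sub: "\<delta> \<subseteq> E" using that by (simp add: multicut_def)
    have "multicut V' T S' ?\<delta>"
      by (rule multicut_mono[OF S'_node_pairs multicut_lift[OF that]]) auto
    then have "\<omega> \<le> (\<Sum>e\<in>?\<delta>. a $ \<phi> e)" by (rule \<omega>_le)
    also have "\<dots> = (\<Sum>e\<in>\<delta>. a $ e)"
    proof (rule sum.reindex_bij_betw)
      have "\<delta> \<subseteq> \<phi> ` ?\<delta>"
      proof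
        fix e assume "e \<in> \<delta>"
        moreover from this have "\<psi> e \<in> T \<and> \<phi> (\<psi> e) = e" using sub \<psi> by blast
        ultimately show "e \<in> \<phi> ` ?\<delta>" by (intro image_eqI[of e \<phi> "\<psi> e"]) simp_all
      qed
      moreover have "\<phi> ` ?\<delta> \<subseteq> \<delta>" by blast
      ultimately have "\<phi> ` ?\<delta> = \<delta>" by blast
      then show "bij_betw \<phi> ?\<delta> \<delta>"
        by (intro bij_betw_subset[OF bij_\<phi>]) blast
    qed
    finally show ?thesis by (simp add: inner_incidence)
  qed
  then have "multicut_polytope V E S \<subseteq> {x. a \<bullet> x \<ge> \<omega>}"
    by (intro multicut_polytope_subset convex_halfspace_ge) simp
  note P = subsetD[OF this]
  \<comment> \<open>The facet is nonempty, so \<open>b\<close> is attained; its polytope part has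
    value at least \<omega> and the added nonnegative part cannot lower it.\<close>
  from facet obtain x where xD: "x \<in> multicut_dominant V E S" and "a \<bullet> x = b"
    by (auto simp: facet_defining_def facet_of_def)
  from xD obtain y z where x: "x = y + z" "y \<in> multicut_polytope V E S"
      "z \<in> edge_space E" "\<And>e. z $ e \<ge> 0"
    unfolding multicut_dominant_def by blast
  have b: "b = a \<bullet> y + a \<bullet> z"
    using \<open>a \<bullet> x = b\<close> x(1) by (simp add: inner_add_right)
  have "a \<bullet> z \<ge> 0"
    unfolding inner_vec_def
  proof (rule sum_nonneg)
    fix e
    show "a $ e \<bullet> z $ e \<ge> 0"
    proof (cases "e \<in> E")
      case True
      then show ?thesis using x(4)[of e] a_nonneg[of e] by simp
    next
      case False
      then show ?thesis using x(3) by (simp add: edge_space_def)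
    qed
  qed
  moreover have "a \<bullet> y \<ge> \<omega>" using P[OF x(2)] by simp
  ultimately show ?thesis using b by linarith
qed

lemma split_coeffs_nonneg: "split_coeffs $ e \<ge> 0"
  using \<omega>_le_b a_nonneg \<phi>_mem by (auto simp: split_coeffs_def reindex_nth axis_def)

lemma polytope_valid: "x \<in> multicut_polytope V' E' S' \<Longrightarrow> split_coeffs \<bullet> x \<ge> b"
proof -
  have "split_coeffs \<bullet> incidence \<delta> \<ge> b" if \<delta>: "multicut V' E' S' \<delta>" for \<delta>
  proof (cases "f \<in> \<delta>")
    case True
    then have "multicut V' T S' (\<delta> - {f})" "\<delta> \<subseteq> E'" using \<delta> multicut_delete_edge by auto
    then show ?thesis using \<omega>_le[of "\<delta> - {f}"] True by (simp add: split_coeffs_incidence)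
  next
    case False
    then have sub: "\<delta> \<subseteq> T" using \<delta> by (auto simp: multicut_def)
    have "b \<le> a \<bullet> incidence (\<phi> ` \<delta>)"
      by (meson False \<delta> incidence_in_polytope multicut_push polytope_subset_dominant subsetD valid)
    \<comment> \<open>Injectivity of \<phi> keeps the weight unchanged under contraction.\<close>
    also have "\<dots> = (\<Sum>e\<in>\<delta>. a $ \<phi> e)"
      unfolding inner_incidence using bij_\<phi> sub
      by (intro sum.reindex_cong[of \<phi>]) (auto simp: bij_betw_def inj_on_subset)
    also have "\<dots> = split_coeffs \<bullet> incidence \<delta>"
      using sub False by (subst split_coeffs_incidence) auto
    finally show ?thesis .
  qed
  then have "multicut_polytope V' E' S' \<subseteq> {x. split_coeffs \<bullet> x \<ge> b}"
    by (intro multicut_polytope_subset) (auto simp: convex_halfspace_ge)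
  then show "x \<in> multicut_polytope V' E' S' \<Longrightarrow> split_coeffs \<bullet> x \<ge> b" by auto
qed

lemma dominant_valid:
  assumes "x \<in> multicut_dominant V' E' S'"
  shows "split_coeffs \<bullet> x \<ge> b"
  using assms
proof (rule multicut_dominantE)
  fix y z assume x: "x = y + z" "y \<in> multicut_polytope V' E' S'" "\<And>e. z $ e \<ge> 0"
  have "split_coeffs \<bullet> z \<ge> 0"
    unfolding inner_vec_def by (rule sum_nonneg) (use x split_coeffs_nonneg in auto)
  then show ?thesis using x polytope_valid[of y] by (simp add: inner_add_right)
qed

text \<open>Add \<open>f\<close> to a minimum cut of the graph without \<open>f\<close>. The point
  is taken in the polytope so that it serves both facet proofs.\<close>

lemma extra_point:
  "\<exists>p\<in>multicut_polytope V' E' S'. split_coeffs \<bullet> p = b \<and> axis f 1 \<bullet> p \<noteq> 0"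
proof -
  obtain \<delta> where \<delta>: "multicut V' T S' \<delta>" "\<omega> = (\<Sum>e\<in>\<delta>. a $ \<phi> e)" using \<omega>_attained by auto
  then have sub: "\<delta> \<subseteq> T" by (simp add: multicut_def)
  then have "insert f \<delta> - {f} = \<delta>" "insert f \<delta> \<subseteq> E'" using f_mem by auto
  then have "multicut V' E' S' (insert f \<delta>)" using \<delta> multicut_delete_edge[of "insert f \<delta>"] by simp
  moreover have "split_coeffs \<bullet> incidence (insert f \<delta>) = b"
    using \<open>insert f \<delta> - {f} = \<delta>\<close> \<open>insert f \<delta> \<subseteq> E'\<close> \<delta>(2) by (simp add: split_coeffs_incidence)
  moreover have "axis f 1 \<bullet> incidence (insert f \<delta>) \<noteq> 0"
    by (simp add: inner_axis' incidence_def)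
  ultimately show ?thesis using incidence_in_polytope by blast
qed

section \<open>The two facets\<close>

lemma axis_L: "axis f 1 \<bullet> L x = 0"
  by (simp add: inner_axis' reindex_nth)

lemma dominant_facet: "facet_defining (multicut_dominant V' E' S') split_coeffs b"
proof -
  obtain p where p: "p \<in> multicut_polytope V' E' S'" "split_coeffs \<bullet> p = b" "axis f 1 \<bullet> p \<noteq> 0"
    using extra_point by auto
  \<comment> \<open>Both dominants span their full edge spaces, and the split graph has exactly one
    more edge.\<close>
  have "aff_dim (multicut_dominant V' E' S') \<le> aff_dim (fixed_edge_space E' {})"
    using multicut_dominant_subset_edge_space
    by (intro aff_dim_subset) (auto simp: fixed_edge_space_def)
  also have "\<dots> \<le> aff_dim (fixed_edge_space E {}) + 1"
    by (rule aff_dim_fixed_edge_space) simp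
  also have "aff_dim (fixed_edge_space E {}) \<le> aff_dim (multicut_dominant V E S)"
    using aff_dim_subset[OF edge_space_subset_dominant_hull[OF S]] by simp
  finally have dim: "aff_dim (multicut_dominant V' E' S') \<le> aff_dim (multicut_dominant V E S) + 1"
    by simp
  have sub: "x \<in> edge_space E" if "x \<in> multicut_dominant V E S" for x
    using that multicut_dominant_subset_edge_space by blast
  show ?thesis
    by (rule facet_defining_lift[where K = K and L = L and p = p and g = "axis f 1", OF facet])
       (use dim p polytope_subset_dominant in \<open>auto simp: convex_multicut_dominant dominant_valid
         linear_reindex K_L sub L_dominant split_coeffs_L axis_L\<close>)
qed

text \<open>By \<open>keep\<close>, an edge \<open>vw\<close> that is also a pair of
  \<open>S\<close> has its copy among the pairs of \<open>S'\<close>. Otherwise a coordinate fixed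
  at 1 would become free, and the dimension would grow by more than the one contributed by
  \<open>f\<close>.\<close>

lemma polytope_facet:
  assumes pfacet: "facet_defining (multicut_polytope V E S) a b"
    and keep: "\<And>w. {v, w} \<in> E \<inter> S \<Longrightarrow> {h w, w} \<in> S'"
  shows "facet_defining (multicut_polytope V' E' S') split_coeffs b"
proof -
  obtain p where p: "p \<in> multicut_polytope V' E' S'" "split_coeffs \<bullet> p = b" "axis f 1 \<bullet> p \<noteq> 0"
    using extra_point by auto
  have \<psi>_mem: "\<psi> e \<in> E' \<inter> S'" if e: "e \<in> E \<inter> S" for e
  proof (cases "v \<in> e")
    case False
    then have "\<psi> e = e" using kept_edge[of e] \<psi>_\<phi>[of e] e by auto
    then show ?thesis using False e \<psi>[of e] by (auto simp: split_pairs_def)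
  next
    case True
    then obtain w where w: "e = {v, w}" using e E by (auto simp: node_pairs_def card_2_iff)
    then have "\<psi> e = {h w, w}" using moved_edge[of w] \<psi>_\<phi>[of "{h w, w}"] e by auto
    then show ?thesis using keep[of w] w e \<psi>[of e] by auto
  qed
  \<comment> \<open>Edges that are pairs have coordinate 1 in every multicut, which bounds the
    dimension of the new polytope from above.\<close>
  have "multicut_polytope V' E' S' \<subseteq> fixed_edge_space E' (E' \<inter> S')"
  proof (rule multicut_polytope_subset[OF convex_fixed_edge_space])
    fix \<delta> assume \<delta>: "multicut V' E' S' \<delta>"
    then have "incidence \<delta> \<in> edge_space E'"
      by (intro incidence_in_edge_space) (simp add: multicut_def)
    then show "incidence \<delta> \<in> fixed_edge_space E' (E' \<inter> S')"
      using multicut_pair_mem[OF S'_node_pairs \<delta>] by (simp add: fixed_edge_space_def incidence_def)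
  qed
  then have "aff_dim (multicut_polytope V' E' S') \<le> aff_dim (fixed_edge_space E' (E' \<inter> S'))"
    by (rule aff_dim_subset)
  also have "\<dots> \<le> aff_dim (fixed_edge_space E (E \<inter> S)) + 1"
    by (rule aff_dim_fixed_edge_space) (use \<psi>_mem in auto)
  also have "aff_dim (fixed_edge_space E (E \<inter> S)) \<le> aff_dim (multicut_polytope V E S)"
    using aff_dim_subset[OF fixed_edge_space_subset_polytope_hull[OF S E]] by simp
  finally have dim: "aff_dim (multicut_polytope V' E' S') \<le> aff_dim (multicut_polytope V E S) + 1"
    by simp
  have sub: "x \<in> edge_space E" if "x \<in> multicut_polytope V E S" for x
    using that multicut_polytope_subset_edge_space by blast
  have "convex (multicut_polytope V' E' S')" by (simp add: multicut_polytope_def)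
  then show ?thesis
    by (intro facet_defining_lift[where K = K and L = L and p = p and g = "axis f 1", OF pfacet])
       (use dim p in \<open>auto simp: polytope_valid
         linear_reindex K_L sub L_polytope split_coeffs_L axis_L\<close>)
qed

end

end

text \<open>The condition on edges in \<open>E \<inter> S\<close> in the shared part keeps
  coordinates that are constantly 1 on the polytope constant after the splitting, which limits the
  growth of its dimension to one.\<close>

theorem theorem4p1:
  fixes V V' :: "'v::finite set" and E E' S S' :: "'v set set"
    and a a' :: "real ^ 'v set" and b \<omega> :: real
    and v v1 v2 :: 'v and h :: "'v \<Rightarrow> 'v" and R :: "'v \<Rightarrow> 'v set set"
    and \<phi> :: "'v set \<Rightarrow> 'v set"
  assumes "simple_graph V E" and "S \<subseteq> node_pairs V"
    and "a \<in> edge_space E"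
    and "facet_defining (multicut_dominant V E S) a b"
    and "v \<in> supp_nodes E a"
    and "v1 \<notin> V" and "v2 \<notin> V" and "v1 \<noteq> v2"
    and "\<And>w. {v, w} \<in> E \<Longrightarrow> h w \<in> {v1, v2}"
    and "\<And>t. {v, t} \<in> S \<Longrightarrow> R t \<subseteq> {{v1, t}, {v2, t}} \<and> R t \<noteq> {}"
    and "V' = split_nodes v v1 v2 V"
    and "E' = split_edges v v1 v2 h E"
    and "S' = split_pairs v R S"
    and "\<phi> = unsplit_edge v v1 v2"
    and "\<omega> = min_multicut_weight V' (E' - {{v1, v2}}) S' (\<lambda>e. a $ \<phi> e)"
    and "a' = (\<chi> e. if e = {v1, v2} then b - \<omega> else if e \<in> E' then a $ \<phi> e else 0)"
  shows "facet_defining (multicut_dominant V' E' S') a' b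
    \<and> ((\<forall>w. {v, w} \<in> E \<inter> S \<longrightarrow> {h w, w} \<in> S') \<and> shared_facet_defining V E S a b
        \<longrightarrow> shared_facet_defining V' E' S' a' b)"
proof -
  have v: "v \<in> V"
    using assms(1,5) by (auto simp: supp_nodes_def simple_graph_def node_pairs_def)
  interpret node_split V E S v v1 v2 h R
    by standard (use assms v in \<open>auto simp: simple_graph_def\<close>)
  note facet = assms(4)
  \<comment> \<open>\<open>L a\<close> vanishes at \<open>f\<close> and off \<open>E'\<close>, so
    adding \<open>b - \<omega>\<close> at \<open>f\<close> reproduces the case distinction.\<close>
  have "a' = split_coeffs a b"
    using f_mem by (auto simp: vec_eq_iff assms split_coeffs_def[OF facet] reindex_nth axis_def)
  then show ?thesis
    using dominant_facet[OF facet] polytope_facet[OF facet]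
    by (auto simp: shared_facet_defining_def assms(11-13))
qed

end
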